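(* Assume $1<|\mathcal X|<|\mathcal Y|$ and $\mathcal W_\kappa(\mathcal Y,\mathcal E)\neq\emptyset$. The following two conditions are equivalent, and if they are satisfied then $\mathcal W_\kappa(\mathcal Y,\mathcal E)$ forms an e-family. (i) For any $P\in\mathcal W_\kappa(\mathcal Y,\mathcal E)$ there exist entrywise non-negative $\mathcal Y\times\mathcal Y$ matrices $D$ and $\Pi$ such that $P=D+\Pi$, where $D$ is diagonal and $\Pi$ is $\kappa$-lumpable with $\kappa_\star\Pi$ having the support of a permutation matrix over $\mathcal X$ (exactly one positive entry in each row and in each column). (ii) For any $(y,y')\in\mathcal E$, $\kappa(y)=\kappa(y')$ implies $y=y'$, and the digraph $\left(\mathcal X,\{(\kappa(y),\kappa(y')):(y,y')\in\mathcal E,\ \kappa(y)\neq\kappa(y')\}\right)$ is a (directed) cycle through all the vertices of $\mathcal X$.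
   Context: Let $\mathcal Y$ be a finite set and $\mathcal E\subset\mathcal Y^2$ a nonempty edge set such that the digraph $(\mathcal Y,\mathcal E)$ is strongly connected. $\mathcal F(\mathcal Y,\mathcal E)=\mathbb R^{\mathcal E}$ is the space of real functions on $\mathcal E$, identified with real $\mathcal Y\times\mathcal Y$ matrices vanishing outside $\mathcal E$; $\mathcal F^+(\mathcal Y,\mathcal E)$ is the subset of those that are strictly positive on $\mathcal E$; $\mathcal W(\mathcal Y,\mathcal E)\subset\mathcal F^+(\mathcal Y,\mathcal E)$ is the set of row-stochastic ones. Let $\kappa\colon\mathcal Y\to\mathcal X$ be surjective, $\mathcal S_x=\kappa^{-1}(x)$, $\mathcal D=\{(\kappa(y),\kappa(y')):(y,y')\in\mathcal E\}$, and write $F(y,\mathcal S_{x'})=\sum_{y'\in\mathcal S_{x'}}F(y,y')$. A $\mathcal Y\times\mathcal Y$ matrix $F$ is $\kappa$-lumpable if $F(y_1,\mathcal S_{x'})=F(y_2,\mathcal S_{x'})$ for all $x,x'\in\mathcal X$ and $y_1,y_2\in\mathcal S_x$, and then $\kappa_\star F(x,x')=F(y,\mathcal S_{x'})$ for any $y\in\mathcal S_x$. $\mathcal W_\kappa(\mathcal Y,\mathcal E)$ is the set of $\kappa$-lumpable $P\in\mathcal W(\mathcal Y,\mathcal E)$. E-families: for $F\in\mathcal F^+(\mathcal Y,\mathcal E)$ with Perron–Frobenius root $\rho_F$ and positive right eigenvector $v_F$, put $\mathfrak s(F)(y,y')=\frac{F(y,y')v_F(y')}{\rho_F v_F(y)}$,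 so $\mathfrak s(F)\in\mathcal W(\mathcal Y,\mathcal E)$. Let $\mathcal N(\mathcal Y,\mathcal E)$ be the linear space of $N\in\mathcal F(\mathcal Y,\mathcal E)$ of the form $N(y,y')=f(y')-f(y)+c$ with $f\in\mathbb R^{\mathcal Y}$, $c\in\mathbb R$. A set $\mathcal V\subset\mathcal W(\mathcal Y,\mathcal E)$ forms an e-family (of dimension $d\ge 0$) if there are $K\in\mathcal F(\mathcal Y,\mathcal E)$ and $G_1,\dots,G_d\in\mathcal F(\mathcal Y,\mathcal E)$, linearly independent modulo $\mathcal N(\mathcal Y,\mathcal E)$, with $\mathcal V=\{\mathfrak s(\exp(K+\sum_{i=1}^d\theta^iG_i)):\theta\in\mathbb R^d\}$, where $\exp$ is applied entrywise on $\mathcal E$. *)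

theory Defs
  imports "HOL-Analysis.Analysis"
begin

text \<open>
  State spaces are finite types; matrices over the state space are elements of
  \<open>real ^ 'y ^ 'y\<close>, with \<open>F $ y $ y'\<close> the entry in row \<open>y\<close> and column \<open>y'\<close>.
  Digraphs are given by their edge sets; self-loops are allowed.
\<close>

definition strongly_connected :: "('y \<times> 'y) set \<Rightarrow> bool" where
  "strongly_connected E \<longleftrightarrow> (\<forall>y y'. (y, y') \<in> E\<^sup>*)"

definition edge_functions :: "('y \<times> 'y) set \<Rightarrow> (real ^ 'y::finite ^ 'y) set" where
  "edge_functions E = {F. \<forall>y y'. (y, y') \<notin> E \<longrightarrow> F $ y $ y' = 0}"

definition pos_edge_functions :: "('y \<times> 'y) set \<Rightarrow> (real ^ 'y::finite ^ 'y) set" where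
  "pos_edge_functions E = {F \<in> edge_functions E. \<forall>(y, y') \<in> E. F $ y $ y' > 0}"

definition stochastic_edge_functions :: "('y \<times> 'y) set \<Rightarrow> (real ^ 'y::finite ^ 'y) set" where
  "stochastic_edge_functions E =
     {P \<in> pos_edge_functions E. \<forall>y. (\<Sum>y'\<in>UNIV. P $ y $ y') = 1}"

definition block_sum :: "('y \<Rightarrow> 'x) \<Rightarrow> real ^ 'y::finite ^ 'y \<Rightarrow> 'y \<Rightarrow> 'x \<Rightarrow> real" where
  "block_sum \<kappa> F y x' = (\<Sum>y' \<in> \<kappa> -` {x'}. F $ y $ y')"

definition lumpable :: "('y \<Rightarrow> 'x) \<Rightarrow> real ^ 'y::finite ^ 'y \<Rightarrow> bool" where
  "lumpable \<kappa> F \<longleftrightarrow>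
     (\<forall>x x'. \<forall>y\<^sub>1 \<in> \<kappa> -` {x}. \<forall>y\<^sub>2 \<in> \<kappa> -` {x}. block_sum \<kappa> F y\<^sub>1 x' = block_sum \<kappa> F y\<^sub>2 x')"

text \<open>The lumped matrix is meaningful for lumpable \<open>F\<close> and surjective \<open>\<kappa>\<close> only; the choice of
  the representative of \<open>x\<close> is then irrelevant.\<close>

definition lump :: "('y \<Rightarrow> 'x) \<Rightarrow> real ^ 'y::finite ^ 'y \<Rightarrow> real ^ 'x::finite ^ 'x" where
  "lump \<kappa> F = (\<chi> x x'. block_sum \<kappa> F (SOME y. \<kappa> y = x) x')"

lemma lump_eq_block_sum:
  assumes "lumpable \<kappa> F"
  shows "lump \<kappa> F $ \<kappa> y $ x' = block_sum \<kappa> F y x'"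
proof -
  have "\<kappa> (SOME z. \<kappa> z = \<kappa> y) = \<kappa> y"
    by (rule someI) (rule refl)
  then have "block_sum \<kappa> F (SOME z. \<kappa> z = \<kappa> y) x' = block_sum \<kappa> F y x'"
    using assms unfolding lumpable_def by blast
  then show ?thesis
    by (simp add: lump_def)
qed

definition lumpable_stochastic ::
  "('y \<Rightarrow> 'x) \<Rightarrow> ('y \<times> 'y) set \<Rightarrow> (real ^ 'y::finite ^ 'y) set" where
  "lumpable_stochastic \<kappa> E = {P \<in> stochastic_edge_functions E. lumpable \<kappa> P}"

text \<open>The Perron--Frobenius root is the spectral radius, taken over the complex eigenvalues.\<close>

definition pf_root :: "real ^ 'y::finite ^ 'y \<Rightarrow> real" where
  "pf_root F = Sup {cmod l | l. \<exists>v. v \<noteq> 0 \<and> map_matrix complex_of_real F *v v = l *s v}"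

text \<open>For irreducible \<open>F\<close> the positive right eigenvector is unique up to a positive factor, which
  cancels in \<open>stochastic_rescaling\<close> below.\<close>

definition pf_vector :: "real ^ 'y::finite ^ 'y \<Rightarrow> real ^ 'y" where
  "pf_vector F = (SOME v. (\<forall>y. v $ y > 0) \<and> F *v v = pf_root F *s v)"

definition stochastic_rescaling :: "real ^ 'y::finite ^ 'y \<Rightarrow> real ^ 'y ^ 'y" where
  "stochastic_rescaling F =
     (\<chi> y y'. F $ y $ y' * pf_vector F $ y' / (pf_root F * pf_vector F $ y))"

definition exp_on :: "('y \<times> 'y) set \<Rightarrow> real ^ 'y::finite ^ 'y \<Rightarrow> real ^ 'y ^ 'y" where
  "exp_on E F = (\<chi> y y'. if (y, y') \<in> E then exp (F $ y $ y') else 0)"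

definition null_functions :: "('y \<times> 'y) set \<Rightarrow> (real ^ 'y::finite ^ 'y) set" where
  "null_functions E =
     {N \<in> edge_functions E. \<exists>(f :: 'y \<Rightarrow> real) (c :: real).
        \<forall>(y, y') \<in> E. N $ y $ y' = f y' - f y + c}"

definition e_family_of_dim ::
  "('y \<times> 'y) set \<Rightarrow> nat \<Rightarrow> (real ^ 'y::finite ^ 'y) set \<Rightarrow> bool" where
  "e_family_of_dim E d V \<longleftrightarrow>
     (\<exists>K (G :: nat \<Rightarrow> real ^ 'y ^ 'y).
        K \<in> edge_functions E \<and> (\<forall>i\<in>{1..d}. G i \<in> edge_functions E) \<and>
        (\<forall>a :: nat \<Rightarrow> real.
           (\<Sum>i = 1..d. a i *\<^sub>R G i) \<in> null_functions E \<longrightarrow> (\<forall>i\<in>{1..d}. a i = 0)) \<and>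
        V = {stochastic_rescaling (exp_on E (K + (\<Sum>i = 1..d. \<theta> i *\<^sub>R G i))) |
               \<theta> :: nat \<Rightarrow> real. True})"

definition e_family :: "('y \<times> 'y) set \<Rightarrow> (real ^ 'y::finite ^ 'y) set \<Rightarrow> bool" where
  "e_family E V \<longleftrightarrow> V \<subseteq> stochastic_edge_functions E \<and> (\<exists>d. e_family_of_dim E d V)"

definition nonneg_matrix :: "real ^ 'y::finite ^ 'y \<Rightarrow> bool" where
  "nonneg_matrix F \<longleftrightarrow> (\<forall>y y'. F $ y $ y' \<ge> 0)"

definition diagonal_matrix :: "real ^ 'y::finite ^ 'y \<Rightarrow> bool" where
  "diagonal_matrix F \<longleftrightarrow> (\<forall>y y'. y \<noteq> y' \<longrightarrow> F $ y $ y' = 0)"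

definition permutation_support :: "real ^ 'x::finite ^ 'x \<Rightarrow> bool" where
  "permutation_support M \<longleftrightarrow>
     (\<forall>x. \<exists>!x'. M $ x $ x' > 0) \<and> (\<forall>x'. \<exists>!x. M $ x $ x' > 0)"

text \<open>A directed cycle through all vertices; for two vertices this is a pair of opposite edges.\<close>

definition spanning_cycle :: "('x::finite \<times> 'x) set \<Rightarrow> bool" where
  "spanning_cycle A \<longleftrightarrow>
     (\<exists>c :: nat \<Rightarrow> 'x. bij_betw c {..<CARD('x)} UNIV \<and>
        A = {(c i, c (Suc i mod CARD('x))) | i. i < CARD('x)})"

end

theory Submission
  imports Defs "HOL-Combinatorics.Orbits"
begin


text \<open>Both conditions say that a transition of \<open>P\<close> either stays where it is or moves on to the next
  block along a fixed cyclic permutation \<open>\<sigma>\<close> of the blocks.  Given a decomposition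
  \<open>P = D + Q\<close> of a single matrix as in (i), every edge \<open>(y, y')\<close> with
  \<open>y \<noteq> y'\<close> carries mass of \<open>Q\<close>, so \<open>\<kappa> y' = \<sigma> (\<kappa> y)\<close> for the permutation
  \<open>\<sigma>\<close> that supports \<open>lump \<kappa> Q\<close>.  Strong connectivity then makes \<open>\<sigma>\<close> act transitively, and a
  transitive self-map of a finite set is a single cycle (\<open>cycle_of_decomposition\<close>).  Conversely,
  if all edges off the diagonal follow a fixed-point-free \<open>\<sigma>\<close>, the diagonal of \<open>P\<close> and the rest
  of \<open>P\<close> are the required summands (\<open>decomposition_of_cycle\<close>).

  Under (ii) a row of a stochastic matrix puts \<open>P $ y $ y\<close> on its own block and the remaining
  mass on the next block, hence \<open>P\<close> is lumpable if and only if its diagonal is a function of the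
  block (\<open>lumpable_iff_diagonal\<close>).  Passing from \<open>F\<close> to \<open>stochastic_rescaling F\<close> divides the
  diagonal by a constant, so it does not affect this property.  In logarithmic coordinates the
  property defines a linear space \<open>A\<close>, which contains the functions \<open>f y' - f y + c\<close>
  because these are constant on loops.  Therefore the lumpable stochastic matrices are exactly the
  rescalings of \<open>exp A\<close>, and any basis of \<open>A\<close> modulo the functions \<open>f y' - f y + c\<close> presents
  them as an e-family with \<open>K = 0\<close> (\<open>e_family_lumpable_stochastic\<close>).

  The rescaling is governed by the Perron--Frobenius theorem.  Existence of a positive eigenvector
  comes from Brouwer's fixed point theorem on the simplex, its uniqueness from subtracting the
  largest possible multiple of one eigenvector from another, and the identification of its
  eigenvalue with the spectral radius from comparing a complex eigenvector with the positive one
  at the coordinate where their ratio is largest.\<close>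

section \<open>Perron--Frobenius theory of strongly connected digraphs\<close>

lemma pos_edge_functions_nonneg:
  "F \<in> pos_edge_functions E \<Longrightarrow> 0 \<le> F $ y $ y'"
  by (cases "(y, y') \<in> E") (force simp: pos_edge_functions_def edge_functions_def)+

lemma pos_edge_functions_pos_iff:
  "F \<in> pos_edge_functions E \<Longrightarrow> 0 < F $ y $ y' \<longleftrightarrow> (y, y') \<in> E"
  by (cases "(y, y') \<in> E") (force simp: pos_edge_functions_def edge_functions_def)+

lemma matrix_vector_mult_pos:
  fixes F :: "real ^ 'n::finite ^ 'm::finite"
  assumes "\<And>b. 0 \<le> F $ a $ b" "\<And>b. 0 \<le> v $ b" "0 < F $ a $ b" "0 < v $ b"
  shows "0 < (F *v v) $ a"
proof -
  have "0 < F $ a $ b * v $ b"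
    using assms by simp
  also have "\<dots> \<le> (\<Sum>b\<in>UNIV. F $ a $ b * v $ b)"
    by (rule member_le_sum) (auto simp: assms)
  finally show ?thesis
    by (simp add: matrix_vector_mult_def)
qed

text \<open>Positivity of one coordinate is inherited by all its predecessors, since
  \<open>(F *v v) $ a > 0\<close> as soon as \<open>a\<close> has an edge into the support of \<open>v\<close>; strong connectivity
  spreads it everywhere.\<close>

lemma nonneg_eigenvector_pos:
  assumes F: "F \<in> pos_edge_functions E" and "strongly_connected E"
    and nonneg: "\<And>y. 0 \<le> v $ y" and "v \<noteq> 0" and eigen: "F *v v = r *s v"
  shows "0 < v $ y"
proof -
  obtain z where "v $ z \<noteq> 0"
    using \<open>v \<noteq> 0\<close> by (auto simp: vec_eq_iff)
  then have "0 < v $ z"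
    using nonneg[of z] by simp
  have "(y, z) \<in> E\<^sup>*"
    using assms by (simp add: strongly_connected_def)
  then show ?thesis
  proof (induction rule: converse_rtrancl_induct)
    case base
    show ?case by fact
  next
    case (step a b)
    have "0 < (F *v v) $ a"
      using F step nonneg
      by (intro matrix_vector_mult_pos[of _ _ _ b])
        (auto simp: pos_edge_functions_pos_iff pos_edge_functions_nonneg)
    then have "v $ a \<noteq> 0"
      by (auto simp: eigen)
    then show ?case
      using nonneg[of a] by simp
  qed
qed

text \<open>With \<open>m\<close> the least ratio \<open>u $ y / v $ y\<close>, the vector \<open>u - m *s v\<close> is a non-negative solution
  of the eigenvalue equation that vanishes somewhere, so it is zero by the previous lemma.\<close>

lemma pos_eigenvector_unique:
  assumes F: "F \<in> pos_edge_functions E" and sc: "strongly_connected E"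
    and u: "\<And>y. 0 < u $ y" "F *v u = r *s u"
    and v: "\<And>y. 0 < v $ y" "F *v v = r *s v"
  obtains m where "0 < m" "u = m *s v"
proof -
  define m where "m = Min (range (\<lambda>y. u $ y / v $ y))"
  have "m \<in> range (\<lambda>y. u $ y / v $ y)"
    unfolding m_def by (rule Min_in) auto
  then obtain z where z: "m = u $ z / v $ z"
    by auto
  have le: "m \<le> u $ y / v $ y" for y
    unfolding m_def by (rule Min_le) auto
  define w where "w = u - m *s v"
  have w_nonneg: "0 \<le> w $ y" for y
    using le[of y] v(1)[of y] by (simp add: w_def field_simps)
  have "w $ z = 0"
    using v(1)[of z] by (simp add: w_def z)
  moreover have "F *v w = r *s w"
    by (simp add: w_def matrix_vector_mult_diff_distrib vector_scalar_commute u v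
        vec.scale_right_diff_distrib vector_smult_assoc mult.commute)
  ultimately have "w = 0"
    using nonneg_eigenvector_pos[OF F sc w_nonneg, of r z] by auto
  moreover have "0 < m"
    using u(1)[of z] v(1)[of z] by (simp add: z)
  ultimately show ?thesis
    using that[of m] by (simp add: w_def)
qed

text \<open>A positive eigenvector can only belong to the spectral radius.  For a complex eigenvector \<open>w\<close>
  and the coordinate \<open>z\<close> where \<open>cmod (w $ z) / v $ z\<close> takes its maximum \<open>m\<close>, the triangle
  inequality gives \<open>cmod l * cmod (w $ z) \<le> m * (F *v v) $ z = r * cmod (w $ z)\<close>.\<close>

lemma pf_root_eqI:
  fixes F :: "real ^ 'y::finite ^ 'y"
  assumes F: "\<And>y y'. 0 \<le> F $ y $ y'"
    and v: "\<And>y. 0 < v $ y" and eigen: "F *v v = r *s v"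
  shows "pf_root F = r"
proof -
  let ?C = "map_matrix complex_of_real F"
  have eigen_sum: "(\<Sum>y'\<in>UNIV. F $ y $ y' * v $ y') = r * v $ y" for y
    using arg_cong[OF eigen, of "\<lambda>x. x $ y"] by (simp add: matrix_vector_mult_def)
  have "0 \<le> r * v $ undefined"
    unfolding eigen_sum[symmetric] by (intro sum_nonneg mult_nonneg_nonneg F less_imp_le[OF v])
  then have r: "0 \<le> r"
    using v[of undefined] by (simp add: zero_le_mult_iff)
  have upper: "cmod l \<le> r" if w: "w \<noteq> 0" "?C *v w = l *s w" for l w
  proof -
    define m where "m = Max (range (\<lambda>y. cmod (w $ y) / v $ y))"
    have "m \<in> range (\<lambda>y. cmod (w $ y) / v $ y)"
      unfolding m_def by (rule Max_in) auto
    then obtain z where z: "m = cmod (w $ z) / v $ z"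
      by auto
    have "cmod (w $ y) / v $ y \<le> m" for y
      unfolding m_def by (rule Max_ge) auto
    with v have le: "cmod (w $ y) \<le> m * v $ y" for y
      by (simp add: pos_divide_le_eq)
    obtain a where "w $ a \<noteq> 0"
      using w by (auto simp: vec_eq_iff)
    then have "0 < m * v $ a"
      using le[of a] by (smt (verit) zero_less_norm_iff)
    then have "0 < m"
      using v[of a] by (simp add: zero_less_mult_iff)
    then have wz: "0 < cmod (w $ z)" and wz_eq: "m * v $ z = cmod (w $ z)"
      using v[of z] by (auto simp: z zero_less_divide_iff)
    have "cmod l * cmod (w $ z) = cmod ((?C *v w) $ z)"
      by (simp add: w norm_mult)
    also have "\<dots> = cmod (\<Sum>y\<in>UNIV. complex_of_real (F $ z $ y) * w $ y)"
      by (simp add: matrix_vector_mult_def map_matrix_def)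
    also have "\<dots> \<le> (\<Sum>y\<in>UNIV. F $ z $ y * cmod (w $ y))"
      by (rule sum_norm_le) (simp add: norm_mult F)
    also have "\<dots> \<le> (\<Sum>y\<in>UNIV. F $ z $ y * (m * v $ y))"
      by (intro sum_mono mult_left_mono le F)
    also have "\<dots> = m * (r * v $ z)"
      by (simp add: eigen_sum[symmetric] sum_distrib_left algebra_simps)
    also have "\<dots> = r * cmod (w $ z)"
      by (simp add: wz_eq[symmetric])
    finally show ?thesis
      using wz by simp
  qed
  have attained: "\<exists>w. w \<noteq> 0 \<and> ?C *v w = complex_of_real r *s w"
  proof (intro exI conjI)
    let ?w = "(\<chi> y. complex_of_real (v $ y)) :: complex ^ 'y"
    show "?w \<noteq> 0"
      using v by (metis of_real_eq_0_iff order_less_irrefl vec_lambda_beta zero_index)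
    show "?C *v ?w = complex_of_real r *s ?w"
      by (simp add: vec_eq_iff matrix_vector_mult_def map_matrix_def
          eigen_sum[symmetric] flip: of_real_mult of_real_sum)
  qed
  show ?thesis
    unfolding pf_root_def
  proof (rule cSup_eq_maximum)
    show "r \<in> {cmod l | l. \<exists>w. w \<noteq> 0 \<and> ?C *v w = l *s w}"
      using attained r by (auto intro!: exI[of _ "complex_of_real r"])
  qed (use upper in auto)
qed

text \<open>Brouwer's theorem is applied to the normalisation of \<open>v + F *v v\<close> rather than of
  \<open>F *v v\<close>: adding \<open>v\<close> keeps the normalising factor \<open>s v\<close> at least 1 on the simplex, so that
  the map is defined and continuous even where \<open>F *v v\<close> vanishes.\<close>

lemma ex_pos_eigenvector:
  fixes F :: "real ^ 'y::finite ^ 'y"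
  assumes F: "F \<in> pos_edge_functions E" and sc: "strongly_connected E"
  obtains v r where "\<And>y. 0 < v $ y" "F *v v = r *s v"
proof -
  define S :: "(real ^ 'y) set" where "S = {v. (\<forall>y. 0 \<le> v $ y) \<and> (\<Sum>y\<in>UNIV. v $ y) = 1}"
  define s where "s v = (\<Sum>y\<in>UNIV. (v + F *v v) $ y)" for v
  define g where "g v = (1 / s v) *\<^sub>R (v + F *v v)" for v
  have F_nonneg: "0 \<le> (F *v v) $ y" if "v \<in> S" for v y
    using that unfolding S_def matrix_vector_mult_def
    by (auto intro!: sum_nonneg mult_nonneg_nonneg pos_edge_functions_nonneg[OF F])
  have s_ge: "1 \<le> s v" if "v \<in> S" for v
  proof -
    have "0 \<le> (\<Sum>y\<in>UNIV. (F *v v) $ y)"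
      by (intro sum_nonneg F_nonneg that)
    then show ?thesis
      using that by (simp add: s_def S_def sum.distrib)
  qed
  have "compact S"
    unfolding compact_eq_bounded_closed
  proof
    show "bounded S"
    proof (rule boundedI[of _ 1])
      fix v assume "v \<in> S"
      then show "norm v \<le> 1"
        using norm_le_l1_cart[of v] by (simp add: S_def)
    qed
    show "closed S"
      unfolding S_def
      by (intro closed_Collect_conj closed_Collect_all closed_Collect_le closed_Collect_eq
          continuous_intros)
  qed
  moreover have "convex S"
  proof (rule convexI)
    fix x y :: "real ^ 'y" and a b :: real
    assume "x \<in> S" "y \<in> S" "0 \<le> a" "0 \<le> b" "a + b = 1"
    then show "a *\<^sub>R x + b *\<^sub>R y \<in> S"
      by (simp add: S_def sum.distrib flip: sum_distrib_left)
  qed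
  moreover have "axis undefined 1 \<in> S"
    by (auto simp: S_def axis_def sum.delta)
  moreover have "continuous_on S g"
    unfolding g_def s_def
  proof (intro continuous_intros matrix_vector_mult_linear_continuous_on)
    show "\<forall>v\<in>S. (\<Sum>y\<in>UNIV. (v + F *v v) $ y) \<noteq> 0"
      using s_ge by (force simp: s_def)
  qed
  moreover have "g \<in> S \<rightarrow> S"
  proof
    fix v assume v: "v \<in> S"
    have "0 \<le> g v $ y" for y
      using v s_ge[OF v] F_nonneg[OF v, of y] by (simp add: g_def S_def)
    moreover have "(\<Sum>y\<in>UNIV. g v $ y) = s v / s v"
      by (subst s_def) (simp add: g_def sum_divide_distrib)
    ultimately show "g v \<in> S"
      using s_ge[OF v] by (simp add: S_def)
  qed
  ultimately obtain v where v: "v \<in> S" "g v = v"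
    using brouwer[of S g] by blast
  have "v + F *v v = s v *s v"
    using arg_cong[OF v(2), of "\<lambda>x. s v *\<^sub>R x"] s_ge[OF v(1)]
    by (simp add: g_def scalar_mult_eq_scaleR)
  then have eigen: "F *v v = (s v - 1) *s v"
    by (simp add: vec.scale_left_diff_distrib algebra_simps)
  have "v \<noteq> 0"
    using v(1) by (auto simp: S_def)
  moreover have "0 \<le> v $ y" for y
    using v(1) by (simp add: S_def)
  ultimately show ?thesis
    using that[OF _ eigen] nonneg_eigenvector_pos[OF F sc _ _ eigen] by blast
qed

lemma eigenvalue_pos:
  assumes F: "F \<in> pos_edge_functions E" and "E \<noteq> {}"
    and v: "\<And>y. 0 < v $ y" and eigen: "F *v v = r *s v"
  shows "0 < r"
proof -
  obtain a b where "(a, b) \<in> E"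
    using \<open>E \<noteq> {}\<close> by auto
  then have "0 < (F *v v) $ a"
    using F v by (intro matrix_vector_mult_pos[of _ _ _ b])
        (auto simp: pos_edge_functions_pos_iff pos_edge_functions_nonneg less_imp_le)
  then show ?thesis
    using v[of a] by (simp add: eigen zero_less_mult_iff)
qed

text \<open>The constant \<open>pf_vector\<close> is an arbitrary choice among positive eigenvectors.  Uniqueness up to
  a factor allows computing the rescaling with any convenient one.\<close>

lemma stochastic_rescaling_eq:
  assumes F: "F \<in> pos_edge_functions E" and sc: "strongly_connected E"
    and v: "\<And>y. 0 < v $ y" and eigen: "F *v v = r *s v"
  shows "stochastic_rescaling F $ y $ y' = F $ y $ y' * v $ y' / (r * v $ y)"
proof -
  have root: "pf_root F = r"
    by (rule pf_root_eqI[OF pos_edge_functions_nonneg[OF F] v eigen])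
  have "(\<forall>y. 0 < pf_vector F $ y) \<and> F *v pf_vector F = pf_root F *s pf_vector F"
    unfolding pf_vector_def by (rule someI[of _ v]) (use v eigen root in auto)
  then obtain m where "0 < m" "pf_vector F = m *s v"
    using pos_eigenvector_unique[OF F sc, of "pf_vector F" r v] v eigen root by auto
  then show ?thesis
    by (simp add: stochastic_rescaling_def root)
qed

lemma stochastic_rescaling_stochastic:
  assumes F: "F \<in> pos_edge_functions E" and sc: "strongly_connected E" and "E \<noteq> {}"
  shows "stochastic_rescaling F \<in> stochastic_edge_functions E"
proof -
  obtain v r where v: "\<And>y. 0 < v $ y" and eigen: "F *v v = r *s v"
    using ex_pos_eigenvector[OF F sc] by blast
  note eq = stochastic_rescaling_eq[OF F sc v eigen]
  have r: "0 < r"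
    by (rule eigenvalue_pos[OF F \<open>E \<noteq> {}\<close> v eigen])
  have "(\<Sum>y'\<in>UNIV. stochastic_rescaling F $ y $ y') = (F *v v) $ y / (r * v $ y)" for y
    by (simp add: eq matrix_vector_mult_def sum_divide_distrib)
  then have "(\<Sum>y'\<in>UNIV. stochastic_rescaling F $ y $ y') = 1" for y
    using r v[of y] by (simp add: eigen)
  then show ?thesis
    using F r v
    by (auto simp: stochastic_edge_functions_def pos_edge_functions_def edge_functions_def eq)
qed

text \<open>The eigenvector cancels on the diagonal; this is why a condition on loops survives rescaling.\<close>

lemma stochastic_rescaling_diagonal:
  assumes F: "F \<in> pos_edge_functions E" and sc: "strongly_connected E"
  shows "stochastic_rescaling F $ y $ y = F $ y $ y / pf_root F"
proof -
  obtain v r where v: "\<And>y. 0 < v $ y" and eigen: "F *v v = r *s v"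
    using ex_pos_eigenvector[OF F sc] by blast
  have "v $ y \<noteq> 0"
    using v[of y] by simp
  then show ?thesis
    using pf_root_eqI[OF pos_edge_functions_nonneg[OF F] v eigen]
    by (simp add: stochastic_rescaling_eq[OF F sc v eigen])
qed

text \<open>Changing \<open>log F\<close> by a function \<open>f y' - f y + c\<close> does not change the rescaling.  If the result
  is already stochastic, then \<open>exp f\<close> is an eigenvector of \<open>F\<close> with eigenvalue \<open>exp (- c)\<close>.\<close>

lemma stochastic_rescaling_eqI:
  assumes F: "F \<in> pos_edge_functions E" and sc: "strongly_connected E"
    and P: "P \<in> stochastic_edge_functions E"
    and cohomologous: "\<And>y y'. (y, y') \<in> E \<Longrightarrow>
      P $ y $ y' = F $ y $ y' * exp (f y' - f y + c)"
  shows "stochastic_rescaling F = P"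
proof -
  have P_eq: "P $ y $ y' = F $ y $ y' * exp (f y' - f y + c)" for y y'
    using cohomologous[of y y'] F P
    by (cases "(y, y') \<in> E")
      (auto simp: stochastic_edge_functions_def pos_edge_functions_def edge_functions_def)
  let ?v = "(\<chi> y. exp (f y)) :: real ^ 'a"
  have "(F *v ?v) $ y = (exp (- c) *s ?v) $ y" for y
  proof -
    have "(F *v ?v) $ y = (\<Sum>y'\<in>UNIV. P $ y $ y' * exp (f y - c))"
      unfolding matrix_vector_mult_def P_eq by (simp add: mult.assoc flip: exp_add)
    also have "\<dots> = exp (f y - c)"
      using P by (simp add: stochastic_edge_functions_def flip: sum_distrib_right)
    finally show ?thesis
      by (simp add: flip: exp_add)
  qed
  then have eigen: "F *v ?v = exp (- c) *s ?v"
    by (simp add: vec_eq_iff)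
  show ?thesis
    by (simp add: vec_eq_iff stochastic_rescaling_eq[OF F sc _ eigen] P_eq exp_add exp_diff
        exp_minus field_simps)
qed

section \<open>Permutations and spanning cycles\<close>

lemma permutation_support_iff:
  "permutation_support M \<longleftrightarrow> (\<exists>\<sigma>. bij \<sigma> \<and> (\<forall>x x'. 0 < M $ x $ x' \<longleftrightarrow> x' = \<sigma> x))"
proof
  assume M: "permutation_support M"
  then obtain \<sigma> where row: "0 < M $ x $ x' \<longleftrightarrow> x' = \<sigma> x" for x x'
    unfolding permutation_support_def by metis
  have "\<exists>!x. x' = \<sigma> x" for x'
    using M by (simp add: permutation_support_def row)
  then have "bij \<sigma>"
    by (metis bijI injI surjI)
  with row show "\<exists>\<sigma>. bij \<sigma> \<and> (\<forall>x x'. 0 < M $ x $ x' \<longleftrightarrow> x' = \<sigma> x)"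
    by blast
next
  assume "\<exists>\<sigma>. bij \<sigma> \<and> (\<forall>x x'. 0 < M $ x $ x' \<longleftrightarrow> x' = \<sigma> x)"
  then show "permutation_support M"
    unfolding permutation_support_def by (metis bij_pointE)
qed

text \<open>The cycle lists the orbit of an arbitrary point up to its first return.  No value is repeated
  before the return, and transitivity makes the orbit everything, so the return time is the
  number of points.\<close>

lemma spanning_cycle_graphI:
  fixes \<sigma> :: "'x::finite \<Rightarrow> 'x"
  assumes transitive: "\<And>x x'. \<exists>n. x' = (\<sigma> ^^ n) x"
  shows "spanning_cycle {(x, \<sigma> x) | x. True}"
proof -
  fix x :: 'x
  \<comment> \<open>Reaching \<open>x\<close> from \<open>\<sigma> x\<close>, not from \<open>x\<close>, guarantees a return in a positive number of steps.\<close>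
  obtain n where "x = (\<sigma> ^^ n) (\<sigma> x)"
    using transitive by blast
  then have self: "x \<in> orbit \<sigma> x"
    by (metis orbit.base funpow_in_orbit)
  then have orbit: "orbit \<sigma> x = UNIV"
    using transitive by (auto simp: orbit_altdef_self_in)
  define p where "p = funpow_dist1 \<sigma> x x"
  define c where "c = (\<lambda>i. (\<sigma> ^^ i) x)"
  have inj: "inj_on c {..<p}"
    using inj_on_funpow_dist1[OF self] by (simp add: c_def p_def lessThan_atLeast0)
  have surj: "c ` {..<p} = UNIV"
    using orbit_conv_funpow_dist1[OF self]
    by (simp add: c_def p_def lessThan_atLeast0 flip: orbit)
  have p: "p = CARD('x)"
    using card_image[OF inj] by (simp add: surj)
  have "c (Suc i mod p) = \<sigma> (c i)" if "i < p" for i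
  proof (cases "Suc i = p")
    case True
    then have "\<sigma> (c i) = x"
      using funpow_dist1_prop[OF self] by (simp add: c_def p_def)
    then show ?thesis
      by (simp add: True c_def)
  next
    case False
    then show ?thesis
      using that by (simp add: c_def)
  qed
  then have "{(x, \<sigma> x) | x. True} = {(c i, c (Suc i mod p)) | i. i < p}"
    using surj by (auto 4 4 simp: image_iff set_eq_iff)
  moreover have "bij_betw c {..<p} UNIV"
    using inj surj by (simp add: bij_betw_def)
  ultimately show ?thesis
    unfolding spanning_cycle_def p by blast
qed

lemma spanning_cycleE:
  fixes A :: "('x::finite \<times> 'x) set"
  assumes "spanning_cycle A"
  obtains \<sigma> where "bij \<sigma>" "A = {(x, \<sigma> x) | x. True}"
proof -
  let ?n = "CARD('x)"
  obtain c where c: "bij_betw c {..<?n} UNIV"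
    and A: "A = {(c i, c (Suc i mod ?n)) | i. i < ?n}"
    using assms by (auto simp: spanning_cycle_def)
  define d where "d = the_inv_into {..<?n} c"
  have d: "bij_betw d UNIV {..<?n}"
    unfolding d_def by (rule bij_betw_the_inv_into[OF c])
  have dc: "d (c i) = i" if "i < ?n" for i
    using that c by (simp add: d_def the_inv_into_f_f bij_betw_def)
  have cd: "c (d x) = x" and d_less: "d x < ?n" for x
    using c d by (auto simp: d_def bij_betw_def f_the_inv_into_f)
  define \<sigma> where "\<sigma> x = c (Suc (d x) mod ?n)" for x
  have "surj \<sigma>"
  proof (rule surjI)
    fix x
    \<comment> \<open>Adding \<open>?n - 1\<close> is stepping back by one modulo \<open>?n\<close> without leaving the naturals.\<close>
    have "Suc ((d x + (?n - 1)) mod ?n) mod ?n = d x"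
      using d_less[of x] by (simp add: mod_Suc_eq)
    then show "\<sigma> (c ((d x + (?n - 1)) mod ?n)) = x"
      by (simp add: \<sigma>_def dc cd)
  qed
  then have "bij \<sigma>"
    by (simp add: bij_def finite_UNIV_surj_inj)
  moreover have "A = {(x, \<sigma> x) | x. True}"
  proof -
    have "(\<exists>i<?n. x = c i \<and> x' = c (Suc i mod ?n)) \<longleftrightarrow> x' = \<sigma> x" for x x'
      unfolding \<sigma>_def by (metis cd d_less dc)
    then show ?thesis
      unfolding A by blast
  qed
  ultimately show ?thesis
    by (rule that)
qed

section \<open>Bases modulo a subspace\<close>

text \<open>A basis of the orthogonal complement of \<open>N\<close> inside \<open>A\<close> is a basis of \<open>A\<close> modulo \<open>N\<close>.  It is
  indexed by an initial segment of the positive natural numbers, as in the coordinates of an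
  e-family.\<close>

lemma ex_basis_modulo_subspace:
  fixes A N :: "'a::euclidean_space set"
  assumes A: "subspace A" and N: "subspace N" and "N \<subseteq> A"
  shows "\<exists>d (G :: nat \<Rightarrow> 'a). (\<forall>i\<in>{1..d}. G i \<in> A) \<and>
    (\<forall>a. (\<Sum>i = 1..d. a i *\<^sub>R G i) \<in> N \<longrightarrow> (\<forall>i\<in>{1..d}. a i = 0)) \<and>
    (\<forall>x\<in>A. \<exists>\<theta>. x - (\<Sum>i = 1..d. \<theta> i *\<^sub>R G i) \<in> N)"
proof -
  define C where "C = A \<inter> {x. \<forall>y\<in>N. orthogonal y x}"
  have C: "subspace C"
    unfolding C_def
    by (rule subspace_inter[OF A subspace_orthogonal_to_vectors])
  obtain B where B: "B \<subseteq> C" "independent B" "C \<subseteq> span B" and "card B = dim C"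
    by (rule basis_exists)
  have "finite B"
    using B(2) by (rule independent_imp_finite)
  then obtain G where G: "bij_betw G {1..card B} B"
    using ex_bij_betw_nat_finite_1 by blast
  define h where "h = the_inv_into {1..card B} G"
  have h: "h (G i) = i" if "i \<in> {1..card B}" for i
    using that G unfolding h_def by (simp add: the_inv_into_f_f bij_betw_def)
  have sum_G: "(\<Sum>i = 1..card B. a i *\<^sub>R G i) = (\<Sum>b\<in>B. a (h b) *\<^sub>R b)" for a
    by (subst sum.reindex_bij_betw[OF G, symmetric]) (simp add: h)
  show ?thesis
  proof (intro exI[of _ "card B"] exI[of _ G] conjI allI impI ballI)
    show "G i \<in> A" if "i \<in> {1..card B}" for i
      using G B(1) that by (auto simp: C_def bij_betw_def)
  next
    fix a :: "nat \<Rightarrow> real" and i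
    let ?s = "\<Sum>i = 1..card B. a i *\<^sub>R G i"
    assume "?s \<in> N" and i: "i \<in> {1..card B}"
    have "?s \<in> C"
      using G B(1) by (intro subspace_sum subspace_scale C) (auto simp: bij_betw_def)
    with \<open>?s \<in> N\<close> have "?s = 0"
      by (auto simp: C_def orthogonal_self)
    then have zero: "a (h b) = 0" if "b \<in> B" for b
      using independentD[OF B(2) \<open>finite B\<close> order_refl, of "\<lambda>b. a (h b)"] that
      unfolding sum_G by blast
    have "G i \<in> B"
      using G i by (auto simp: bij_betw_def)
    then show "a i = 0"
      using zero[of "G i"] by (simp only: h[OF i])
  next
    fix x assume "x \<in> A"
    obtain y z where y: "y \<in> span N" and z: "\<And>w. w \<in> span N \<Longrightarrow> orthogonal z w"
      and x: "x = y + z"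
      using orthogonal_subspace_decomp_exists by blast
    have "y \<in> N"
      using y N by (simp add: span_eq_iff[THEN iffD2])
    have "z \<in> A"
      using subspace_diff[OF A \<open>x \<in> A\<close>, of y] \<open>y \<in> N\<close> \<open>N \<subseteq> A\<close> x by auto
    then have "z \<in> span B"
      using z B(3) by (auto simp: C_def orthogonal_commute span_base)
    then obtain u where "z = (\<Sum>b\<in>B. u b *\<^sub>R b)"
      using span_finite[OF \<open>finite B\<close>] by auto
    also have "\<dots> = (\<Sum>i = 1..card B. u (G i) *\<^sub>R G i)"
      by (rule sum.reindex_bij_betw[OF G, symmetric])
    finally show "\<exists>\<theta>. x - (\<Sum>i = 1..card B. \<theta> i *\<^sub>R G i) \<in> N"
      using \<open>y \<in> N\<close> x by (intro exI[of _ "\<lambda>i. u (G i)"]) simp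
  qed
qed

section \<open>The null functions as a linear space\<close>

lemma null_functionsI:
  assumes "M \<in> edge_functions E"
    and "\<And>y y'. (y, y') \<in> E \<Longrightarrow> M $ y $ y' = f y' - f y + c"
  shows "M \<in> null_functions E"
  using assms unfolding null_functions_def by blast

lemma null_functionsE:
  assumes "M \<in> null_functions E"
  obtains f c where "M \<in> edge_functions E"
    and "\<And>y y'. (y, y') \<in> E \<Longrightarrow> M $ y $ y' = f y' - f y + c"
  using assms unfolding null_functions_def by blast

lemma subspace_edge_functions: "subspace (edge_functions E)"
  by (auto simp: subspace_def edge_functions_def)

lemma subspace_null_functions: "subspace (null_functions E)"
proof (rule subspaceI)
  show "0 \<in> null_functions E"
    by (rule null_functionsI[of _ _ "\<lambda>_. 0" 0]) (auto simp: subspace_0 subspace_edge_functions)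
next
  fix M N
  assume "M \<in> null_functions E" "N \<in> null_functions E"
  then obtain f c g d where M: "M \<in> edge_functions E"
      "\<And>y y'. (y, y') \<in> E \<Longrightarrow> M $ y $ y' = f y' - f y + c"
    and N: "N \<in> edge_functions E"
      "\<And>y y'. (y, y') \<in> E \<Longrightarrow> N $ y $ y' = g y' - g y + d"
    by (metis null_functionsE)
  show "M + N \<in> null_functions E"
    by (rule null_functionsI[of _ _ "\<lambda>y. f y + g y" "c + d"])
      (auto simp: M N subspace_add subspace_edge_functions)
next
  fix a M
  assume "M \<in> null_functions E"
  then obtain f c where M: "M \<in> edge_functions E"
      "\<And>y y'. (y, y') \<in> E \<Longrightarrow> M $ y $ y' = f y' - f y + c"
    by (metis null_functionsE)
  show "a *\<^sub>R M \<in> null_functions E"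
    by (rule null_functionsI[of _ _ "\<lambda>y. a * f y" "a * c"])
      (auto simp: M subspace_scale subspace_edge_functions algebra_simps)
qed

section \<open>Lumpings whose blocks are visited cyclically\<close>

text \<open>This is the part of condition (ii) that determines the block sums.  The absence of fixed
  points separates the diagonal of a matrix from its other entries: staying in a block is
  possible only by a loop.\<close>

locale cyclic_lumping =
  fixes E :: "('y::finite \<times> 'y) set" and \<kappa> :: "'y \<Rightarrow> 'x::finite" and \<sigma> :: "'x \<Rightarrow> 'x"
  assumes step: "\<And>y y'. (y, y') \<in> E \<Longrightarrow> y \<noteq> y' \<Longrightarrow> \<kappa> y' = \<sigma> (\<kappa> y)"
    and no_fix: "\<And>x. \<sigma> x \<noteq> x"
begin

lemma block_sum_cyclic:
  assumes P: "P \<in> stochastic_edge_functions E"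
  shows "block_sum \<kappa> P y x' =
    (if x' = \<kappa> y then P $ y $ y else if x' = \<sigma> (\<kappa> y) then 1 - P $ y $ y else 0)"
proof -
  have zero: "P $ y $ y' = 0" if "y \<noteq> y'" "\<kappa> y' \<noteq> \<sigma> (\<kappa> y)" for y'
    using P step[of y y'] that
    by (auto simp: stochastic_edge_functions_def pos_edge_functions_def edge_functions_def)
  have own: "block_sum \<kappa> P y (\<kappa> y) = P $ y $ y"
  proof -
    have "block_sum \<kappa> P y (\<kappa> y) = (\<Sum>y'\<in>{y}. P $ y $ y')"
      unfolding block_sum_def
      using no_fix[of "\<kappa> y"] by (intro sum.mono_neutral_right) (auto intro!: zero)
    then show ?thesis
      by simp
  qed
  have other: "block_sum \<kappa> P y x' = 0" if "x' \<noteq> \<kappa> y" "x' \<noteq> \<sigma> (\<kappa> y)"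
    unfolding block_sum_def using that by (intro sum.neutral) (auto intro!: zero)
  have "block_sum \<kappa> P y (\<sigma> (\<kappa> y)) = (\<Sum>y'\<in>UNIV - {y}. P $ y $ y')"
    unfolding block_sum_def using no_fix[of "\<kappa> y"]
    by (intro sum.mono_neutral_left) (auto intro!: zero)
  also have "\<dots> = 1 - P $ y $ y"
    using P by (simp add: stochastic_edge_functions_def sum_diff1)
  finally show ?thesis
    using own other no_fix by auto
qed

text \<open>By \<open>block_sum_cyclic\<close> a whole row of block sums is determined by the block and the diagonal
  entry, so lumpability reduces to linear constraints on the loops.\<close>

lemma lumpable_iff_diagonal:
  assumes P: "P \<in> stochastic_edge_functions E"
  shows "lumpable \<kappa> P \<longleftrightarrow> (\<exists>h. \<forall>y. P $ y $ y = h (\<kappa> y))"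
proof
  assume "lumpable \<kappa> P"
  then have "P $ y $ y = lump \<kappa> P $ \<kappa> y $ \<kappa> y" for y
    by (simp add: lump_eq_block_sum block_sum_cyclic[OF P])
  then show "\<exists>h. \<forall>y. P $ y $ y = h (\<kappa> y)"
    by (intro exI[of _ "\<lambda>x. lump \<kappa> P $ x $ x"]) blast
next
  assume "\<exists>h. \<forall>y. P $ y $ y = h (\<kappa> y)"
  then obtain h where "\<And>y. P $ y $ y = h (\<kappa> y)"
    by blast
  then show "lumpable \<kappa> P"
    by (auto simp: lumpable_def block_sum_cyclic[OF P])
qed

text \<open>The set \<open>L\<close> collects the blocks whose states have loops.  That loops are present in all states
  of a block or in none is needed for the null functions to lie in \<open>A\<close>: their diagonal entry
  is \<open>c\<close> at a loop and 0 elsewhere.\<close>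

lemma e_family_lumpable_stochastic:
  assumes "E \<noteq> {}" and sc: "strongly_connected E"
    and loops: "\<And>y. (y, y) \<in> E \<longleftrightarrow> \<kappa> y \<in> L"
  shows "e_family E (lumpable_stochastic \<kappa> E)"
proof -
  define A :: "(real ^ 'y ^ 'y) set"
    where "A = {H \<in> edge_functions E. \<exists>h. \<forall>y. H $ y $ y = h (\<kappa> y)}"
  have A: "subspace A"
  proof (rule subspaceI)
    show "0 \<in> A"
      by (auto simp: A_def subspace_0 subspace_edge_functions intro: exI[of _ "\<lambda>_. 0"])
  next
    fix M N assume "M \<in> A" "N \<in> A"
    then obtain g h where "M \<in> edge_functions E" "\<And>y. M $ y $ y = g (\<kappa> y)"
      "N \<in> edge_functions E" "\<And>y. N $ y $ y = h (\<kappa> y)"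
      unfolding A_def by blast
    then show "M + N \<in> A"
      by (auto simp: A_def subspace_add subspace_edge_functions
          intro!: exI[of _ "\<lambda>x. g x + h x"])
  next
    fix a M assume "M \<in> A"
    then obtain h where "M \<in> edge_functions E" "\<And>y. M $ y $ y = h (\<kappa> y)"
      unfolding A_def by blast
    then show "a *\<^sub>R M \<in> A"
      by (auto simp: A_def subspace_scale subspace_edge_functions
          intro!: exI[of _ "\<lambda>x. a * h x"])
  qed
  have "null_functions E \<subseteq> A"
  proof
    fix M assume "M \<in> null_functions E"
    then obtain f c where M: "M \<in> edge_functions E"
      and eq: "\<And>y y'. (y, y') \<in> E \<Longrightarrow> M $ y $ y' = f y' - f y + c"
      by (metis null_functionsE)
    have "M $ y $ y = (if \<kappa> y \<in> L then c else 0)" for y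
      using M eq[of y y] loops[of y] by (auto simp: edge_functions_def)
    then show "M \<in> A"
      using M by (auto simp: A_def intro!: exI[of _ "\<lambda>x. if x \<in> L then c else 0"])
  qed
  from ex_basis_modulo_subspace[OF A subspace_null_functions this]
  obtain d :: nat and G where G: "\<forall>i\<in>{1..d}. G i \<in> A"
    and indep: "\<forall>a. (\<Sum>i = 1..d. a i *\<^sub>R G i) \<in> null_functions E \<longrightarrow> (\<forall>i\<in>{1..d}. a i = 0)"
    and spans: "\<forall>H\<in>A. \<exists>\<theta>. H - (\<Sum>i = 1..d. \<theta> i *\<^sub>R G i) \<in> null_functions E"
    by blast
  let ?H = "\<lambda>\<theta> :: nat \<Rightarrow> real. \<Sum>i = 1..d. \<theta> i *\<^sub>R G i"
  have H: "?H \<theta> \<in> A" for \<theta>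
    using G by (intro subspace_sum subspace_scale A) blast
  have exp_pos: "exp_on E M \<in> pos_edge_functions E" for M
    by (auto simp: exp_on_def pos_edge_functions_def edge_functions_def)
  have sound: "stochastic_rescaling (exp_on E (?H \<theta>)) \<in> lumpable_stochastic \<kappa> E" for \<theta>
  proof -
    have P: "stochastic_rescaling (exp_on E (?H \<theta>)) \<in> stochastic_edge_functions E"
      by (rule stochastic_rescaling_stochastic[OF exp_pos sc \<open>E \<noteq> {}\<close>])
    obtain h where h: "\<And>y. ?H \<theta> $ y $ y = h (\<kappa> y)"
      using H[of \<theta>] unfolding A_def by blast
    have "exp_on E (?H \<theta>) $ y $ y = (if \<kappa> y \<in> L then exp (h (\<kappa> y)) else 0)" for y
      by (simp only: exp_on_def vec_lambda_beta h loops)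
    then have "\<exists>h. \<forall>y. stochastic_rescaling (exp_on E (?H \<theta>)) $ y $ y = h (\<kappa> y)"
      unfolding stochastic_rescaling_diagonal[OF exp_pos sc]
      by (intro exI[of _ "\<lambda>x. (if x \<in> L then exp (h x) else 0) / pf_root (exp_on E (?H \<theta>))"])
        (simp only: simp_thms)
    then show ?thesis
      using P lumpable_iff_diagonal[OF P]
      by (simp only: lumpable_stochastic_def mem_Collect_eq simp_thms)
  qed
  have complete: "\<exists>\<theta>. P = stochastic_rescaling (exp_on E (?H \<theta>))"
    if "P \<in> lumpable_stochastic \<kappa> E" for P
  proof -
    have P: "P \<in> stochastic_edge_functions E" and "lumpable \<kappa> P"
      using that by (auto simp: lumpable_stochastic_def)
    then obtain h where h: "\<And>y. P $ y $ y = h (\<kappa> y)"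
      using lumpable_iff_diagonal[OF P] by blast
    \<comment> \<open>Since \<open>ln 0 = 0\<close>, the entrywise logarithm vanishes off the edges by itself.\<close>
    define K :: "real ^ 'y ^ 'y" where "K = (\<chi> y y'. ln (P $ y $ y'))"
    have "K \<in> A"
      using P by (auto simp: A_def K_def h edge_functions_def stochastic_edge_functions_def
          pos_edge_functions_def intro!: exI[of _ "\<lambda>x. ln (h x)"])
    then obtain \<theta> where "K - ?H \<theta> \<in> null_functions E"
      using spans by blast
    then obtain f c where eq: "(K - ?H \<theta>) $ y $ y' = f y' - f y + c" if "(y, y') \<in> E" for y y'
      by (rule null_functionsE) (rule that)
    have "P $ y $ y' = exp_on E (?H \<theta>) $ y $ y' * exp (f y' - f y + c)"
      if e: "(y, y') \<in> E" for y y'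
    proof -
      have "0 < P $ y $ y'"
        using P e by (auto simp: stochastic_edge_functions_def pos_edge_functions_def)
      then have "P $ y $ y' = exp (K $ y $ y')"
        by (simp add: K_def)
      also have "K $ y $ y' = ?H \<theta> $ y $ y' + (f y' - f y + c)"
        unfolding eq[OF e, symmetric] by (simp del: sum_component)
      finally show ?thesis
        using e by (simp only: exp_on_def exp_add vec_lambda_beta if_True)
    qed
    then have "stochastic_rescaling (exp_on E (?H \<theta>)) = P"
      by (rule stochastic_rescaling_eqI[OF exp_pos sc P])
    then show ?thesis
      by blast
  qed
  have "e_family_of_dim E d (lumpable_stochastic \<kappa> E)"
    unfolding e_family_of_dim_def
  proof (intro exI[of _ 0] exI[of _ G] conjI)
    show "0 \<in> edge_functions E"
      by (simp add: edge_functions_def)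
    show "\<forall>i\<in>{1..d}. G i \<in> edge_functions E"
      using G by (simp add: A_def)
    show "\<forall>a. ?H a \<in> null_functions E \<longrightarrow> (\<forall>i\<in>{1..d}. a i = 0)"
      by (rule indep)
    show "lumpable_stochastic \<kappa> E =
        {stochastic_rescaling (exp_on E (0 + ?H \<theta>)) | \<theta>. True}"
      using sound complete by auto
  qed
  then show ?thesis
    by (auto simp: e_family_def lumpable_stochastic_def)
qed

text \<open>Removing the diagonal leaves the mass \<open>1 - P $ y $ y\<close> on the next block only.  It is positive,
  because some state of the block has an edge to the next block and the diagonal entry is the
  same throughout the block.\<close>

lemma decomposition_of_cycle:
  assumes P: "P \<in> lumpable_stochastic \<kappa> E" and "bij \<sigma>"
    and edge: "\<And>x. \<exists>y y'. (y, y') \<in> E \<and> \<kappa> y = x \<and> \<kappa> y' = \<sigma> x"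
  obtains D Q where "nonneg_matrix D" "nonneg_matrix Q" "P = D + Q"
    "diagonal_matrix D" "lumpable \<kappa> Q" "permutation_support (lump \<kappa> Q)"
proof -
  have P_st: "P \<in> stochastic_edge_functions E" and "lumpable \<kappa> P"
    using P by (auto simp: lumpable_stochastic_def)
  then have P_pos: "P \<in> pos_edge_functions E"
    by (simp add: stochastic_edge_functions_def)
  obtain h where h: "\<And>y. P $ y $ y = h (\<kappa> y)"
    using lumpable_iff_diagonal[OF P_st] \<open>lumpable \<kappa> P\<close> by blast
  define D :: "real ^ 'y ^ 'y" where "D = (\<chi> y y'. if y = y' then P $ y $ y' else 0)"
  define Q where "Q = P - D"
  have block_D: "block_sum \<kappa> D y x' = (if x' = \<kappa> y then P $ y $ y else 0)" for y x'
    by (auto simp: block_sum_def D_def sum.delta')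
  have block_Q: "block_sum \<kappa> Q y x' = (if x' = \<sigma> (\<kappa> y) then 1 - P $ y $ y else 0)" for y x'
  proof -
    have "block_sum \<kappa> Q y x' = block_sum \<kappa> P y x' - block_sum \<kappa> D y x'"
      by (simp add: block_sum_def Q_def sum_subtractf)
    then show ?thesis
      using no_fix[of "\<kappa> y"] by (auto simp: block_sum_cyclic[OF P_st] block_D)
  qed
  have Q: "nonneg_matrix Q"
    using P_pos by (auto simp: nonneg_matrix_def Q_def D_def pos_edge_functions_nonneg)
  have lump_Q: "lumpable \<kappa> Q"
    by (auto simp: lumpable_def block_Q h)
  have less_1: "P $ y $ y < 1" for y
  proof -
    obtain a b where ab: "(a, b) \<in> E" "\<kappa> a = \<kappa> y" "\<kappa> b = \<sigma> (\<kappa> y)"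
      using edge by blast
    then have "0 < P $ a $ b" "a \<noteq> b"
      using P_pos no_fix[of "\<kappa> y"] by (auto simp: pos_edge_functions_pos_iff)
    then have "0 < Q $ a $ b"
      by (simp add: Q_def D_def)
    also have "\<dots> \<le> block_sum \<kappa> Q a (\<kappa> b)"
      unfolding block_sum_def using Q by (intro member_le_sum) (auto simp: nonneg_matrix_def)
    also have "\<dots> = 1 - P $ y $ y"
      using ab by (simp add: block_Q h)
    finally show ?thesis
      by simp
  qed
  have "0 < lump \<kappa> Q $ x $ x' \<longleftrightarrow> x' = \<sigma> x" for x x'
  proof -
    obtain y where "x = \<kappa> y"
      using edge by metis
    then show ?thesis
      using less_1[of y] by (simp add: lump_eq_block_sum[OF lump_Q] block_Q)
  qed
  then have "permutation_support (lump \<kappa> Q)"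
    using \<open>bij \<sigma>\<close> by (auto simp: permutation_support_iff)
  moreover have "nonneg_matrix D"
    using P_pos by (simp add: nonneg_matrix_def D_def pos_edge_functions_nonneg)
  moreover have "diagonal_matrix D"
    by (simp add: diagonal_matrix_def D_def)
  moreover have "P = D + Q"
    by (simp add: Q_def)
  ultimately show ?thesis
    using Q lump_Q by (intro that)
qed

end

section \<open>The cycle behind a decomposition\<close>

text \<open>One decomposed matrix suffices, since all matrices in question have the support \<open>E\<close>.  The
  bound on the number of blocks excludes a fixed point of \<open>\<sigma>\<close>: a transitive map that fixes a
  point lives on a single point.\<close>

lemma cycle_of_decomposition:
  fixes E :: "('y::finite \<times> 'y) set" and \<kappa> :: "'y \<Rightarrow> 'x::finite"
  assumes sc: "strongly_connected E" and "surj \<kappa>" and "1 < CARD('x)"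
    and P: "P \<in> pos_edge_functions E" and decomp: "P = D + Q"
    and D: "nonneg_matrix D" "diagonal_matrix D"
    and Q: "nonneg_matrix Q" "lumpable \<kappa> Q" "permutation_support (lump \<kappa> Q)"
  shows "(\<forall>(y, y')\<in>E. \<kappa> y = \<kappa> y' \<longrightarrow> y = y') \<and>
    spanning_cycle {(\<kappa> y, \<kappa> y') | y y'. (y, y') \<in> E \<and> \<kappa> y \<noteq> \<kappa> y'}"
proof -
  obtain \<sigma> where \<sigma>: "0 < lump \<kappa> Q $ x $ x' \<longleftrightarrow> x' = \<sigma> x" for x x'
    using Q(3) unfolding permutation_support_iff by blast
  have step: "\<kappa> y' = \<sigma> (\<kappa> y)" if "(y, y') \<in> E" "y \<noteq> y'" for y y'
  proof -
    have "0 < P $ y $ y'"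
      using P that by (simp add: pos_edge_functions_pos_iff)
    then have "0 < Q $ y $ y'"
      using D(2) that by (simp add: decomp diagonal_matrix_def)
    also have "\<dots> \<le> block_sum \<kappa> Q y (\<kappa> y')"
      unfolding block_sum_def using Q(1) by (intro member_le_sum) (auto simp: nonneg_matrix_def)
    finally show ?thesis
      by (simp add: \<sigma> flip: lump_eq_block_sum[OF Q(2)])
  qed
  have reach: "\<exists>n. \<kappa> y' = (\<sigma> ^^ n) (\<kappa> y)" for y y'
  proof -
    have "(y, y') \<in> E\<^sup>*"
      using sc by (simp add: strongly_connected_def)
    then show ?thesis
    proof (induction rule: rtrancl_induct)
      case base
      show ?case
        by (rule exI[of _ 0]) simp
    next
      case (step a b)
      then obtain n where n: "\<kappa> a = (\<sigma> ^^ n) (\<kappa> y)"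
        by blast
      show ?case
      proof (cases "a = b")
        case False
        then have "\<kappa> b = (\<sigma> ^^ Suc n) (\<kappa> y)"
          using \<open>(a, b) \<in> E\<close> \<open>\<And>y y'. (y, y') \<in> E \<Longrightarrow> y \<noteq> y' \<Longrightarrow> \<kappa> y' = \<sigma> (\<kappa> y)\<close> n by simp
        then show ?thesis
          by blast
      qed (use n in blast)
    qed
  qed
  then have transitive: "\<exists>n. x' = (\<sigma> ^^ n) x" for x x'
    using \<open>surj \<kappa>\<close> by (metis surjD)
  have no_fix: "\<sigma> x \<noteq> x" for x
  proof
    assume "\<sigma> x = x"
    then have "(\<sigma> ^^ n) x = x" for n
      by (induction n) auto
    then have "x' = x" for x'
      using transitive by metis
    then have "(UNIV :: 'x set) = {x}"
      by blast
    then have "CARD('x) = card {x}"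
      by (rule arg_cong)
    then show False
      using \<open>1 < CARD('x)\<close> by simp
  qed
  have edge: "\<exists>y y'. (y, y') \<in> E \<and> \<kappa> y = x \<and> \<kappa> y' = \<sigma> x" for x
  proof -
    obtain y where y: "\<kappa> y = x"
      using \<open>surj \<kappa>\<close> by (metis surjD)
    then have "0 < block_sum \<kappa> Q y (\<sigma> x)"
      by (simp add: \<sigma> flip: lump_eq_block_sum[OF Q(2)])
    then obtain y' where y': "\<kappa> y' = \<sigma> x" "0 < Q $ y $ y'"
      unfolding block_sum_def using sum_nonpos by (metis not_less vimage_singleton_eq)
    have "0 < P $ y $ y'"
      using y'(2) D(1) by (simp add: decomp nonneg_matrix_def add_nonneg_pos)
    then show ?thesis
      using P y y' by (auto simp: pos_edge_functions_pos_iff)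
  qed
  have "{(\<kappa> y, \<kappa> y') | y y'. (y, y') \<in> E \<and> \<kappa> y \<noteq> \<kappa> y'} = {(x, \<sigma> x) | x. True}"
  proof (intro equalityI subsetI)
    fix e assume "e \<in> {(\<kappa> y, \<kappa> y') | y y'. (y, y') \<in> E \<and> \<kappa> y \<noteq> \<kappa> y'}"
    then show "e \<in> {(x, \<sigma> x) | x. True}"
      using step by blast
  next
    fix e assume "e \<in> {(x, \<sigma> x) | x. True}"
    then obtain x where "e = (x, \<sigma> x)"
      by blast
    then show "e \<in> {(\<kappa> y, \<kappa> y') | y y'. (y, y') \<in> E \<and> \<kappa> y \<noteq> \<kappa> y'}"
      using edge[of x] no_fix[of x] by (auto, metis)
  qed
  then have "spanning_cycle {(\<kappa> y, \<kappa> y') | y y'. (y, y') \<in> E \<and> \<kappa> y \<noteq> \<kappa> y'}"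
    by (simp only: spanning_cycle_graphI[OF transitive])
  moreover have "y = y'" if "(y, y') \<in> E" "\<kappa> y = \<kappa> y'" for y y'
    using step[OF that(1)] that(2) no_fix[of "\<kappa> y"] by auto
  ultimately show ?thesis
    by blast
qed

section \<open>The equivalence and the e-family\<close>

theorem proposition4p1:
  fixes E :: "('y::finite \<times> 'y) set" and \<kappa> :: "'y \<Rightarrow> 'x::finite"
  assumes "E \<noteq> {}" and "strongly_connected E"
    and "surj \<kappa>"
    and "1 < CARD('x)" and "CARD('x) < CARD('y)"
    and "lumpable_stochastic \<kappa> E \<noteq> {}"
  shows "let
      cond_i =
        (\<forall>P \<in> lumpable_stochastic \<kappa> E. \<exists>D Q.
           nonneg_matrix D \<and> nonneg_matrix Q \<and> P = D + Q \<and>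
           diagonal_matrix D \<and> lumpable \<kappa> Q \<and> permutation_support (lump \<kappa> Q));
      cond_ii =
        ((\<forall>(y, y') \<in> E. \<kappa> y = \<kappa> y' \<longrightarrow> y = y') \<and>
         spanning_cycle {(\<kappa> y, \<kappa> y') | y y'. (y, y') \<in> E \<and> \<kappa> y \<noteq> \<kappa> y'})
    in (cond_i \<longleftrightarrow> cond_ii) \<and>
       (cond_i \<and> cond_ii \<longrightarrow> e_family E (lumpable_stochastic \<kappa> E))"
proof -
  define cond_i where "cond_i \<longleftrightarrow> (\<forall>P \<in> lumpable_stochastic \<kappa> E. \<exists>D Q.
    nonneg_matrix D \<and> nonneg_matrix Q \<and> P = D + Q \<and>
    diagonal_matrix D \<and> lumpable \<kappa> Q \<and> permutation_support (lump \<kappa> Q))"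
  define A where "A = {(\<kappa> y, \<kappa> y') | y y'. (y, y') \<in> E \<and> \<kappa> y \<noteq> \<kappa> y'}"
  define cond_ii where
    "cond_ii \<longleftrightarrow> (\<forall>(y, y') \<in> E. \<kappa> y = \<kappa> y' \<longrightarrow> y = y') \<and> spanning_cycle A"
  obtain P where P: "P \<in> lumpable_stochastic \<kappa> E"
    using assms(6) by blast
  then have P_st: "P \<in> stochastic_edge_functions E" and P_pos: "P \<in> pos_edge_functions E"
    and "lumpable \<kappa> P"
    by (auto simp: lumpable_stochastic_def stochastic_edge_functions_def)
  have i_imp_ii: cond_ii if cond_i
  proof -
    obtain D Q where "nonneg_matrix D" "nonneg_matrix Q" "P = D + Q"
      "diagonal_matrix D" "lumpable \<kappa> Q" "permutation_support (lump \<kappa> Q)"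
      using \<open>cond_i\<close> P unfolding cond_i_def by blast
    then show ?thesis
      unfolding cond_ii_def A_def
      using cycle_of_decomposition[OF assms(2-4) P_pos] by blast
  qed
  have ii_imp: "cond_i \<and> e_family E (lumpable_stochastic \<kappa> E)" if cond_ii
  proof -
    obtain \<sigma> where "bij \<sigma>" and A: "A = {(x, \<sigma> x) | x. True}"
      using \<open>cond_ii\<close> spanning_cycleE unfolding cond_ii_def by blast
    have graph: "(x, x') \<in> A \<longleftrightarrow> x' = \<sigma> x" for x x'
      by (auto simp: A)
    have no_fix: "\<sigma> x \<noteq> x" for x
    proof -
      have "(x, \<sigma> x) \<in> A"
        by (simp add: graph)
      then show ?thesis
        unfolding A_def by auto
    qed
    have step: "\<kappa> y' = \<sigma> (\<kappa> y)" if "(y, y') \<in> E" "y \<noteq> y'" for y y'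
    proof -
      have "\<kappa> y \<noteq> \<kappa> y'"
        using \<open>cond_ii\<close> that unfolding cond_ii_def by blast
      with that have "(\<kappa> y, \<kappa> y') \<in> A"
        unfolding A_def by blast
      then show ?thesis
        by (simp add: graph)
    qed
    interpret cyclic_lumping E \<kappa> \<sigma>
      by unfold_locales (fact step no_fix)+
    have edge: "\<exists>y y'. (y, y') \<in> E \<and> \<kappa> y = x \<and> \<kappa> y' = \<sigma> x" for x
    proof -
      have "(x, \<sigma> x) \<in> A"
        by (simp add: graph)
      then show ?thesis
        unfolding A_def by (auto, metis)
    qed
    obtain h where "\<And>y. P $ y $ y = h (\<kappa> y)"
      using lumpable_iff_diagonal[OF P_st] \<open>lumpable \<kappa> P\<close> by blast
    \<comment> \<open>The existence of one lumpable matrix makes the loop pattern a property of the block.\<close>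
    then have loops: "(y, y) \<in> E \<longleftrightarrow> \<kappa> y \<in> {x. 0 < h x}" for y
      by (simp flip: pos_edge_functions_pos_iff[OF P_pos])
    have cond_i
      unfolding cond_i_def
    proof
      fix R assume "R \<in> lumpable_stochastic \<kappa> E"
      from decomposition_of_cycle[OF this \<open>bij \<sigma>\<close> edge]
      show "\<exists>D Q. nonneg_matrix D \<and> nonneg_matrix Q \<and> R = D + Q \<and>
          diagonal_matrix D \<and> lumpable \<kappa> Q \<and> permutation_support (lump \<kappa> Q)"
        by metis
    qed
    moreover have "e_family E (lumpable_stochastic \<kappa> E)"
      by (rule e_family_lumpable_stochastic[OF assms(1,2) loops])
    ultimately show ?thesis
      by blast
  qed
  have "(cond_i \<longleftrightarrow> cond_ii) \<and> (cond_i \<and> cond_ii \<longrightarrow> e_family E (lumpable_stochastic \<kappa> E))"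
    using i_imp_ii ii_imp by blast
  then show ?thesis
    unfolding Let_def cond_i_def cond_ii_def A_def .
qed

end
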